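(* Let $C_x\subset\mathbb{R}^n$ and $C_u\subset\mathbb{R}^m$. Suppose the function $\mathcal{L}:\mathbb{R}^n\times\mathbb{R}^m\to\mathbb{R}$ is proper, lower semicontinuous, convex (jointly in its two arguments), and strictly convex in its second argument. Let the set-valued map $D:C_x\rightrightarrows C_u$ be continuous, with nonempty and convex values. For each $x\in C_x$ define $$\kappa^*(x):=\operatorname*{arg\,min}_{u\in D(x)}\ \mathcal{L}(x,u).$$ If one of the following conditions holds: 1) $\mathcal{L}$ is sublevel bounded in $u$; 2) $D$ has bounded values, namely, for each $x\in C_x$, $D(x)$ is bounded; then $\kappa^*$ is single valued on $C_x$ (i.e., for each $x\in C_x$ there is exactly one minimizer) and continuous on $\operatorname{int}(C_x)$.
   Context: A set-valued map $D:C_x\rightrightarrows C_u$ is outer semicontinuous at $x\in C_x$ if for all sequences $x_i\in C_x$, $x_i\to x$, and $y_i\in D(x_i)$ with $y_i\to y\in\mathbb{R}^m$, we have $y\in D(x)$. It is lower semicontinuous at $x\in C_x$ if for every open set $V$ with $D(x)\cap V\ne\emptyset$ there is a neighborhood $U(x)$ of $x$ with $D(z)\cap V\neq\emptyset$ for all $z\in U(x)\cap C_x$. It is continuous if it is both outer and lower semicontinuous at every $x\in C_x$. A function $f:\mathbb{R}^m\to\mathbb{R}\cup\{\pm\infty\}$ is sublevel bounded if for every finite $\alpha\in\mathbb{R}$ the set $\{u: f(u)\le\alpha\}$ is bounded. "$\mathcal{L}$ is sublevel bounded in $u$" means that for each $x$ the function $u\mapsto\mathcal{L}(x,u)$ is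 sublevel bounded. A function is proper if it never takes the value $-\infty$ and is finite somewhere (automatic for real-valued $\mathcal{L}$). *)

theory Defs
  imports "HOL-Analysis.Analysis"
begin

text \<open>
  Extended-real-valued functions have codomain \<open>ereal\<close>; real-valued ones are
  embedded with \<open>ereal\<close>.
\<close>

definition proper_fun :: "('a \<Rightarrow> ereal) \<Rightarrow> bool" where
  "proper_fun f \<longleftrightarrow> (\<forall>z. f z \<noteq> - \<infinity>) \<and> (\<exists>z. \<bar>f z\<bar> \<noteq> \<infinity>)"

definition lsc_fun :: "('a::topological_space \<Rightarrow> ereal) \<Rightarrow> bool" where
  "lsc_fun f \<longleftrightarrow> (\<forall>z. f z \<le> Liminf (nhds z) f)"

definition sublevel_bounded :: "('a::metric_space \<Rightarrow> ereal) \<Rightarrow> bool" where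
  "sublevel_bounded f \<longleftrightarrow> (\<forall>\<alpha>::real. bounded {u. f u \<le> ereal \<alpha>})"

definition strictly_convex_on :: "'a::real_vector set \<Rightarrow> ('a \<Rightarrow> real) \<Rightarrow> bool" where
  "strictly_convex_on S f \<longleftrightarrow> convex S \<and>
    (\<forall>x\<in>S. \<forall>y\<in>S. \<forall>s>0. \<forall>t>0. x \<noteq> y \<longrightarrow> s + t = 1 \<longrightarrow>
       f (s *\<^sub>R x + t *\<^sub>R y) < s * f x + t * f y)"

text \<open>
  A set-valued map with domain \<open>A\<close> is a total function into sets; its values
  outside \<open>A\<close> are never inspected.
\<close>

definition set_osc_at ::
    "'a::topological_space set \<Rightarrow> ('a \<Rightarrow> 'b::topological_space set) \<Rightarrow> 'a \<Rightarrow> bool" where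
  "set_osc_at A D x \<longleftrightarrow>
    (\<forall>X Y y. (\<forall>i::nat. X i \<in> A) \<and> X \<longlonglongrightarrow> x \<and> (\<forall>i. Y i \<in> D (X i)) \<and> Y \<longlonglongrightarrow> y
       \<longrightarrow> y \<in> D x)"

definition set_lsc_at ::
    "'a::topological_space set \<Rightarrow> ('a \<Rightarrow> 'b::topological_space set) \<Rightarrow> 'a \<Rightarrow> bool" where
  "set_lsc_at A D x \<longleftrightarrow>
    (\<forall>V. open V \<and> D x \<inter> V \<noteq> {} \<longrightarrow>
       (\<exists>U. open U \<and> x \<in> U \<and> (\<forall>z\<in>U \<inter> A. D z \<inter> V \<noteq> {})))"

definition set_continuous_on ::
    "'a::topological_space set \<Rightarrow> ('a \<Rightarrow> 'b::topological_space set) \<Rightarrow> bool" where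
  "set_continuous_on A D \<longleftrightarrow> (\<forall>x\<in>A. set_osc_at A D x \<and> set_lsc_at A D x)"

definition argmin_map :: "('a \<times> 'b \<Rightarrow> real) \<Rightarrow> ('a \<Rightarrow> 'b set) \<Rightarrow> 'a \<Rightarrow> 'b set" where
  "argmin_map L D x = {u. is_arg_min (\<lambda>v. L (x, v)) (\<lambda>v. v \<in> D x) u}"

end

theory Submission
  imports Defs
begin

text \<open>
  A finite convex function on a finite-dimensional space is continuous, so \<open>L\<close> is continuous
  in both arguments at once.  Outer semicontinuity of \<open>D\<close>, applied to constant sequences of
  points, makes its values closed.  Existence of a minimizer is then compactness, either of
  \<open>D x\<close> or of its intersection with a sublevel set, and uniqueness is strict convexity: the
  midpoint of two minimizers would do better.

  The delicate point in the continuity of the minimizer \<open>\<kappa> x\<close> is that \<open>\<kappa> z\<close> might escape to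
  infinity as \<open>z\<close> tends to \<open>x\<close>, because neither of the two boundedness conditions is uniform in
  \<open>x\<close>.  Convexity circumvents this.  If \<open>\<kappa> z\<close> stays at distance at least \<open>\<epsilon>\<close> from \<open>\<kappa> x\<close>
  for some \<open>z\<close> arbitrarily near \<open>x\<close>, then lower semicontinuity of \<open>D\<close> supplies points
  \<open>v \<in> D z\<close> tending to \<open>\<kappa> x\<close>, and the segment from \<open>v\<close> to \<open>\<kappa> z\<close> crosses the sphere of radius
  \<open>\<epsilon>\<close> about \<open>\<kappa> x\<close> in a point \<open>w\<close>.  That point lies in \<open>D z\<close>, since \<open>D z\<close> is convex, and
  satisfies \<open>L (z, w) \<le> L (z, v)\<close>, since the other endpoint \<open>\<kappa> z\<close> is a minimizer.  The
  sphere is compact, so the points \<open>w\<close> accumulate at some \<open>w'\<close> on it; outer semicontinuity gives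
  \<open>w' \<in> D x\<close>, and continuity of \<open>L\<close> gives \<open>L (x, w') \<le> L (x, \<kappa> x)\<close>.  So \<open>w'\<close> is a second
  minimizer at \<open>x\<close>, which is impossible.  This is \<open>argmin_selection_continuous\<close> below.
\<close>

lemma strictly_convex_on_imp_convex_on:
  assumes "strictly_convex_on S f"
  shows "convex_on S f"
proof -
  have "f (s *\<^sub>R x + t *\<^sub>R y) \<le> s * f x + t * f y"
    if "x \<in> S" "y \<in> S" "s \<ge> 0" "t \<ge> 0" "s + t = 1" for x y s t
  proof (cases "x = y \<or> s = 0 \<or> t = 0")
    case True
    with \<open>s + t = 1\<close> show ?thesis
      by (auto simp flip: scaleR_left_distrib distrib_right)
  next
    case False
    then have "f (s *\<^sub>R x + t *\<^sub>R y) < s * f x + t * f y"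
      using assms that unfolding strictly_convex_on_def by simp
    then show ?thesis by simp
  qed
  then show ?thesis
    using assms by (simp add: convex_on_def strictly_convex_on_def)
qed

lemma strictly_convex_on_arg_min_unique:
  assumes f: "strictly_convex_on S f" and T: "convex T" "T \<subseteq> S"
    and u: "is_arg_min f (\<lambda>v. v \<in> T) u" and v: "is_arg_min f (\<lambda>v. v \<in> T) v"
  shows "u = v"
proof (rule ccontr)
  assume "u \<noteq> v"
  let ?m = "(1/2) *\<^sub>R u + (1/2) *\<^sub>R v"
  have uv: "u \<in> T" "v \<in> T" "f u \<le> f v" "f v \<le> f u"
    using u v by (auto simp: is_arg_min_linorder)
  have "f ?m < (1/2) * f u + (1/2) * f v"
    using f[unfolded strictly_convex_on_def, THEN conjunct2, rule_format, of u v "1/2" "1/2"]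
      \<open>u \<noteq> v\<close> uv T(2) by auto
  moreover have "?m \<in> T"
    using uv by (intro convexD[OF T(1)]) auto
  then have "f u \<le> f ?m"
    using u by (auto simp: is_arg_min_linorder)
  ultimately show False using uv by simp
qed

lemma set_osc_at_imp_closed:
  fixes D :: "'a::topological_space \<Rightarrow> 'b::first_countable_topology set"
  assumes "set_osc_at A D x" "x \<in> A"
  shows "closed (D x)"
  unfolding closed_sequential_limits
proof (intro allI impI)
  fix Y y assume "(\<forall>n. Y n \<in> D x) \<and> Y \<longlonglongrightarrow> y"
  then show "y \<in> D x"
    using assms unfolding set_osc_at_def by (elim allE[of _ "\<lambda>_. x"]) auto
qed

text \<open>
  In the sublevel-bounded case the part of \<open>S\<close> below the level of any one of its points is
  compact, and a minimizer on that part is a minimizer on \<open>S\<close>.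
\<close>

lemma ex_arg_min_coercive_or_bounded:
  fixes f :: "'a::heine_borel \<Rightarrow> real"
  assumes f: "continuous_on UNIV f" and S: "closed S" "S \<noteq> {}"
    and bdd: "sublevel_bounded (\<lambda>u. ereal (f u)) \<or> bounded S"
  shows "\<exists>u. is_arg_min f (\<lambda>v. v \<in> S) u"
proof -
  obtain a where a: "a \<in> S" using S by blast
  let ?T = "S \<inter> {u. f u \<le> f a}"
  have "closed ?T"
    using f S by (intro closed_Int closed_Collect_le) auto
  moreover have "bounded ?T"
    using bdd by (auto simp: sublevel_bounded_def intro: bounded_subset)
  ultimately have "compact ?T" by (simp add: compact_eq_bounded_closed)
  moreover have "a \<in> ?T" using a by simp
  ultimately have "\<exists>u\<in>?T. \<forall>v\<in>?T. f u \<le> f v"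
    by (intro continuous_attains_inf continuous_on_subset[OF f]) auto
  then obtain u where u: "u \<in> ?T" "\<And>v. v \<in> ?T \<Longrightarrow> f u \<le> f v" by blast
  have "f u \<le> f v" if "v \<in> S" for v
    using u that by (cases "f v \<le> f a") auto
  then show ?thesis using u(1) by (auto simp: is_arg_min_linorder)
qed

text \<open>
  Replacing a far-away minimizer by a point at distance exactly \<open>\<epsilon>\<close> from \<open>p\<close>: on the segment
  from \<open>v\<close> to a minimizer \<open>u\<close> a convex function does not exceed its value at \<open>v\<close>.
\<close>

lemma sphere_point_below:
  fixes f :: "'b::real_normed_vector \<Rightarrow> real"
  assumes f: "convex_on S f"
    and u: "is_arg_min f (\<lambda>y. y \<in> S) u" and v: "v \<in> S"
    and near: "dist p v < \<epsilon>" and far: "\<epsilon> \<le> dist p u"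
  obtains w where "w \<in> S" "w \<in> sphere p \<epsilon>" "f w \<le> f v"
proof -
  have uS: "u \<in> S" "f u \<le> f v"
    using u v by (auto simp: is_arg_min_linorder)
  have "closed_segment v u \<inter> frontier (ball p \<epsilon>) \<noteq> {}"
    using near far by (intro connected_Int_frontier) auto
  moreover have "0 < \<epsilon>" using near zero_le_dist[of p v] by linarith
  ultimately obtain w where w: "w \<in> closed_segment v u" "w \<in> sphere p \<epsilon>"
    by (auto simp del: mem_sphere)
  have "w \<in> S"
    using w(1) closed_segment_subset[OF v uS(1) convex_on_imp_convex[OF f]] by blast
  moreover have "f w \<le> f v"
  proof -
    obtain t where t: "0 \<le> t" "t \<le> 1" "w = (1 - t) *\<^sub>R v + t *\<^sub>R u"
      using w(1) by (auto simp: in_segment)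
    then have "f w \<le> max (f v) (f u)"
      using convex_lower[OF f v uS(1), of "1 - t" t] by simp
    then show ?thesis using uS(2) by simp
  qed
  ultimately show ?thesis using w(2) that by blast
qed

text \<open>
  The comparison points found by \<open>sphere_point_below\<close> lie on one fixed compact sphere.  This takes
  the place of a bound on the minimizers near \<open>x\<close>, on which the compactness argument of Berge's
  maximum theorem rests.
\<close>

lemma argmin_selection_continuous:
  fixes L :: "'a::metric_space \<times> 'b::euclidean_space \<Rightarrow> real"
  assumes L: "continuous_on UNIV L"
    and strict: "\<And>x. x \<in> A \<Longrightarrow> strictly_convex_on UNIV (\<lambda>u. L (x, u))"
    and D: "set_continuous_on A D" and conv: "\<And>x. x \<in> A \<Longrightarrow> convex (D x)"
    and \<kappa>: "\<And>x. x \<in> A \<Longrightarrow> \<kappa> x \<in> argmin_map L D x"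
  shows "continuous_on A \<kappa>"
proof (rule ccontr)
  assume "\<not> continuous_on A \<kappa>"
  then obtain x \<epsilon> where x: "x \<in> A" and \<epsilon>: "0 < \<epsilon>"
    and far: "\<And>r. 0 < r \<Longrightarrow> \<exists>z\<in>A. dist z x < r \<and> \<epsilon> \<le> dist (\<kappa> z) (\<kappa> x)"
    unfolding continuous_on_iff by (metis not_less)
  have \<kappa>D: "\<kappa> x \<in> D x"
    using \<kappa>[OF x] by (simp add: argmin_map_def is_arg_min_linorder)

  have pick: "\<exists>z v w. z \<in> A \<and> dist z x < r \<and> dist (\<kappa> x) v < r \<and>
      w \<in> D z \<and> w \<in> sphere (\<kappa> x) \<epsilon> \<and> L (z, w) \<le> L (z, v)" if "0 < r" for r
  proof -
    \<comment> \<open>The radius is cut down to \<open>\<epsilon>\<close> so that \<open>v\<close> lies inside the sphere.\<close>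
    define \<rho> where "\<rho> = min r \<epsilon>"
    have "0 < \<rho>" using that \<epsilon> by (simp add: \<rho>_def)
    then have "D x \<inter> ball (\<kappa> x) \<rho> \<noteq> {}" using \<kappa>D by auto
    moreover have "set_lsc_at A D x" using D x by (simp add: set_continuous_on_def)
    ultimately obtain U where U: "open U" "x \<in> U" "\<And>z. z \<in> U \<inter> A \<Longrightarrow> D z \<inter> ball (\<kappa> x) \<rho> \<noteq> {}"
      unfolding set_lsc_at_def by (metis open_ball)
    then obtain d where d: "0 < d" "\<And>z. dist z x < d \<Longrightarrow> z \<in> U"
      unfolding open_dist by blast
    obtain z where z: "z \<in> A" "dist z x < min d r" "\<epsilon> \<le> dist (\<kappa> z) (\<kappa> x)"
      using far[of "min d r"] d(1) \<open>0 < r\<close> by auto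
    then obtain v where v: "v \<in> D z" "dist (\<kappa> x) v < \<rho>"
      using U(3)[of z] d(2)[of z] by auto
    have "is_arg_min (\<lambda>y. L (z, y)) (\<lambda>y. y \<in> D z) (\<kappa> z)"
      using \<kappa>[OF z(1)] by (simp add: argmin_map_def)
    moreover have "convex_on (D z) (\<lambda>y. L (z, y))"
      by (rule convex_on_subset[OF strictly_convex_on_imp_convex_on[OF strict[OF z(1)]]])
        (auto intro: conv[OF z(1)])
    ultimately obtain w where "w \<in> D z" "w \<in> sphere (\<kappa> x) \<epsilon>" "L (z, w) \<le> L (z, v)"
      using sphere_point_below[of "D z" "\<lambda>y. L (z, y)" "\<kappa> z" v "\<kappa> x" \<epsilon>] v z(3)
      by (auto simp: \<rho>_def dist_commute)
    then show ?thesis using z v(2) by (auto simp: \<rho>_def)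
  qed
  have "\<forall>n. \<exists>z v w. z \<in> A \<and> dist z x < inverse (real (Suc n)) \<and>
      dist (\<kappa> x) v < inverse (real (Suc n)) \<and>
      w \<in> D z \<and> w \<in> sphere (\<kappa> x) \<epsilon> \<and> L (z, w) \<le> L (z, v)"
    by (intro allI pick) simp
  then obtain Z V W where ZVW: "\<And>n. Z n \<in> A" "\<And>n. dist (Z n) x < inverse (real (Suc n))"
    "\<And>n. dist (\<kappa> x) (V n) < inverse (real (Suc n))"
    "\<And>n. W n \<in> D (Z n)" "\<And>n. W n \<in> sphere (\<kappa> x) \<epsilon>" "\<And>n. L (Z n, W n) \<le> L (Z n, V n)"
    by metis
  have Z: "Z \<longlonglongrightarrow> x"
    unfolding tendsto_dist_iff[of Z] using ZVW(2)
    by (intro tendsto_sandwich[OF _ _ tendsto_const LIMSEQ_inverse_real_of_nat] always_eventually)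
      (auto intro: less_imp_le)
  have V: "V \<longlonglongrightarrow> \<kappa> x"
    unfolding tendsto_dist_iff[of V] using ZVW(3)
    by (intro tendsto_sandwich[OF _ _ tendsto_const LIMSEQ_inverse_real_of_nat] always_eventually)
      (auto intro: less_imp_le simp: dist_commute)
  have "compact (sphere (\<kappa> x) \<epsilon>)" by simp
  then obtain w' r where w': "w' \<in> sphere (\<kappa> x) \<epsilon>" and r: "strict_mono (r::nat \<Rightarrow> nat)"
    and W: "(W \<circ> r) \<longlonglongrightarrow> w'"
    unfolding compact_def using ZVW(5) by blast
  have Zr: "(Z \<circ> r) \<longlonglongrightarrow> x" and Vr: "(V \<circ> r) \<longlonglongrightarrow> \<kappa> x"
    using Z V r by (simp_all add: LIMSEQ_subseq_LIMSEQ)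

  have "set_osc_at A D x" using D x by (simp add: set_continuous_on_def)
  then have w'D: "w' \<in> D x"
    unfolding set_osc_at_def using ZVW(1,4) Zr W
    by (elim allE[of _ "Z \<circ> r"] allE[of _ "W \<circ> r"] allE[of _ w']) auto

  have L_lim: "(\<lambda>n. L ((Z \<circ> r) n, Y n)) \<longlonglongrightarrow> L (x, y)" if "Y \<longlonglongrightarrow> y" for Y y
    by (intro continuous_on_tendsto_compose[OF L] tendsto_Pair Zr that) auto
  have "L (x, w') \<le> L (x, \<kappa> x)"
    using ZVW(6) by (intro LIMSEQ_le[OF L_lim[OF W] L_lim[OF Vr]]) auto
  then have "is_arg_min (\<lambda>y. L (x, y)) (\<lambda>y. y \<in> D x) w'"
    using \<kappa>[OF x] w'D unfolding argmin_map_def is_arg_min_linorder by (auto intro: order_trans)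
  moreover have "is_arg_min (\<lambda>y. L (x, y)) (\<lambda>y. y \<in> D x) (\<kappa> x)"
    using \<kappa>[OF x] by (simp add: argmin_map_def)
  ultimately have "w' = \<kappa> x"
    using strictly_convex_on_arg_min_unique[OF strict[OF x] conv[OF x]] by auto
  then show False using w' \<epsilon> by simp
qed

theorem lemma3:
  fixes C\<^sub>x :: "(real ^ 'n) set"
    and C\<^sub>u :: "(real ^ 'm) set"
    and L :: "(real ^ 'n) \<times> (real ^ 'm) \<Rightarrow> real"
    and D :: "real ^ 'n \<Rightarrow> (real ^ 'm) set"
  assumes L_proper: "proper_fun (\<lambda>z. ereal (L z))"
    and L_lsc: "lsc_fun (\<lambda>z. ereal (L z))"
    and L_convex: "convex_on UNIV L"
    and L_strictly_convex: "\<And>x. strictly_convex_on UNIV (\<lambda>u. L (x, u))"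
    and D_into: "\<And>x. x \<in> C\<^sub>x \<Longrightarrow> D x \<subseteq> C\<^sub>u"
    and D_continuous: "set_continuous_on C\<^sub>x D"
    and D_nonempty: "\<And>x. x \<in> C\<^sub>x \<Longrightarrow> D x \<noteq> {}"
    and D_convex: "\<And>x. x \<in> C\<^sub>x \<Longrightarrow> convex (D x)"
    and bounded_cases:
      "(\<forall>x. sublevel_bounded (\<lambda>u. ereal (L (x, u)))) \<or> (\<forall>x\<in>C\<^sub>x. bounded (D x))"
  shows "(\<forall>x\<in>C\<^sub>x. \<exists>!u. u \<in> argmin_map L D x) \<and>
         continuous_on (interior C\<^sub>x) (\<lambda>x. THE u. u \<in> argmin_map L D x)"
proof
  have L_cont: "continuous_on UNIV L"
    using convex_on_continuous[OF open_UNIV L_convex] .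
  show unique: "\<forall>x\<in>C\<^sub>x. \<exists>!u. u \<in> argmin_map L D x"
  proof
    fix x assume x: "x \<in> C\<^sub>x"
    have "continuous_on UNIV (\<lambda>u. L (x, u))"
      by (intro continuous_on_compose2[OF L_cont] continuous_intros) auto
    moreover have "closed (D x)"
      using D_continuous x by (intro set_osc_at_imp_closed[of C\<^sub>x]) (auto simp: set_continuous_on_def)
    ultimately have "\<exists>u. is_arg_min (\<lambda>u. L (x, u)) (\<lambda>u. u \<in> D x) u"
      using D_nonempty[OF x] bounded_cases x by (intro ex_arg_min_coercive_or_bounded) auto
    then show "\<exists>!u. u \<in> argmin_map L D x"
      using strictly_convex_on_arg_min_unique[OF L_strictly_convex D_convex[OF x]]
      by (auto simp: argmin_map_def)
  qed
  have "continuous_on C\<^sub>x (\<lambda>x. THE u. u \<in> argmin_map L D x)"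
  proof (rule argmin_selection_continuous[OF L_cont L_strictly_convex D_continuous D_convex])
    show "(THE u. u \<in> argmin_map L D x) \<in> argmin_map L D x" if "x \<in> C\<^sub>x" for x
      using unique that by (intro theI'[of "\<lambda>u. u \<in> argmin_map L D x"]) blast
  qed
  then show "continuous_on (interior C\<^sub>x) (\<lambda>x. THE u. u \<in> argmin_map L D x)"
    by (rule continuous_on_subset) (rule interior_subset)
qed

end
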